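(* Let $m\geq 2$ and let $\mathbf{P}=(X_1,\ldots,X_m;\preceq)$ be an $m$-partite poset. Then \[ \dim(\mathbf{P})\leq \left\lfloor \frac{(m-1)(m+3)}{4}\right\rfloor B(\mathbf{P}), \] where $B(\mathbf{P})=\max_{1\le i<j\le m}\dim(\mathbf{P}_{i,j})$.
   Context: All posets are finite. The order dimension $\dim(\mathbf{Q})$ of a poset $\mathbf{Q}=(X,\preceq)$ is the least number $d$ of linear extensions $\preceq_1,\ldots,\preceq_d$ of $\preceq$ such that for all $x,y\in X$: $x\preceq y$ iff $x\preceq_i y$ for all $i\in[d]$. For an integer $m\geq 2$ and disjoint nonempty sets $X_1,\ldots,X_m$, $\mathbf{P}=(X_1,\ldots,X_m;\preceq)$ is an $m$-partite poset if $\preceq$ is a partial order on $X=X_1\cup\cdots\cup X_m$ such that (1) each $X_i$ is an antichain, and (2) $x\prec y$ implies $x\in X_i$, $y\in X_j$ with $i<j$. Its dimension is that of the poset $(X,\preceq)$. For $i<j$, $\mathbf{P}_{i,j}$ denotes the sub-poset of $\mathbf{P}$ induced on $X_i\cup X_j$. *)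

theory Defs
  imports "HOL-Library.Disjoint_Sets"
begin

text \<open>
  A poset is given by a carrier set \<open>A\<close> and a reflexive order relation \<open>r\<close> on it
  (\<^const>\<open>partial_order_on\<close>, which includes \<open>r \<subseteq> A \<times> A\<close>).
\<close>

definition linear_extension :: "'a set \<Rightarrow> 'a rel \<Rightarrow> 'a rel \<Rightarrow> bool" where
  "linear_extension A r l \<longleftrightarrow> linear_order_on A l \<and> r \<subseteq> l"

definition realized_by :: "'a set \<Rightarrow> 'a rel \<Rightarrow> nat \<Rightarrow> (nat \<Rightarrow> 'a rel) \<Rightarrow> bool" where
  "realized_by A r d L \<longleftrightarrow>
     (\<forall>i\<in>{1..d}. linear_extension A r (L i)) \<and>
     (\<forall>x\<in>A. \<forall>y\<in>A. (x, y) \<in> r \<longleftrightarrow> (\<forall>i\<in>{1..d}. (x, y) \<in> L i))"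

text \<open>
  For \<open>d = 0\<close> the condition on the right is vacuously true, so posets with at most one element
  have dimension 0; all other finite posets have dimension at least 1.
\<close>

definition order_dim :: "'a set \<Rightarrow> 'a rel \<Rightarrow> nat" where
  "order_dim A r = (LEAST d. \<exists>L. realized_by A r d L)"

definition antichain_in :: "'a rel \<Rightarrow> 'a set \<Rightarrow> bool" where
  "antichain_in r A \<longleftrightarrow> (\<forall>x\<in>A. \<forall>y\<in>A. (x, y) \<in> r \<longrightarrow> x = y)"

definition multipartite_poset :: "nat \<Rightarrow> (nat \<Rightarrow> 'a set) \<Rightarrow> 'a rel \<Rightarrow> bool" where
  "multipartite_poset m X r \<longleftrightarrow>
     m \<ge> 2 \<and>
     (\<forall>i\<in>{1..m}. finite (X i) \<and> X i \<noteq> {}) \<and>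
     disjoint_family_on X {1..m} \<and>
     partial_order_on (\<Union>i\<in>{1..m}. X i) r \<and>
     (\<forall>i\<in>{1..m}. antichain_in r (X i)) \<and>
     (\<forall>x y. (x, y) \<in> r \<and> x \<noteq> y \<longrightarrow>
        (\<exists>i\<in>{1..m}. \<exists>j\<in>{1..m}. x \<in> X i \<and> y \<in> X j \<and> i < j))"

definition multipartite_dim :: "nat \<Rightarrow> (nat \<Rightarrow> 'a set) \<Rightarrow> 'a rel \<Rightarrow> nat" where
  "multipartite_dim m X r = order_dim (\<Union>i\<in>{1..m}. X i) r"

definition pair_dim :: "(nat \<Rightarrow> 'a set) \<Rightarrow> 'a rel \<Rightarrow> nat \<Rightarrow> nat \<Rightarrow> nat" where
  "pair_dim X r i j = order_dim (X i \<union> X j) (r \<inter> (X i \<union> X j) \<times> (X i \<union> X j))"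

definition max_pair_dim :: "nat \<Rightarrow> (nat \<Rightarrow> 'a set) \<Rightarrow> 'a rel \<Rightarrow> nat" where
  "max_pair_dim m X r = Max {pair_dim X r i j | i j. 1 \<le> i \<and> i < j \<and> j \<le> m}"

end

theory Submission
  imports Defs
begin

text \<open>
  Regard a pair \<open>i < j\<close> as the interval \<open>[i, j]\<close>. If several such intervals are pairwise disjoint,
  then linear extensions of the corresponding bipartite subposets extend simultaneously to one
  linear extension of the whole poset: stack the intervals lexicographically. A point \<open>p\<close> lies in
  \<open>p (m + 1 - p) - 1 \<le> \<lfloor>(m - 1) (m + 3) / 4\<rfloor>\<close> of the intervals, so greedy colouring splits them into
  that many classes of pairwise disjoint intervals, and each class costs at most \<open>B\<close> linear
  extensions.
\<close>

section \<open>Extending partial orders\<close>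

lemma finite_partial_orders_on:
  assumes "finite A"
  shows "finite {s. partial_order_on A s}"
  by (rule finite_subset[of _ "Pow (A \<times> A)"])
    (use assms in \<open>auto simp: partial_order_on_def preorder_on_def\<close>)

text \<open>One passage through \<open>L\<close> is enough: an \<open>r\<close>-step between two
  passages joins points of \<open>C\<close> and so lies in \<open>L\<close>. For \<open>C\<close>
  inside \<open>A\<close> the relation is therefore the transitive closure of
  \<open>r \<union> L\<close>. A cycle in it either stays in \<open>r\<close> or closes up inside
  \<open>L\<close>, and both are antisymmetric.\<close>

lemma partial_order_on_amalgamation:
  assumes r: "partial_order_on A r"
    and L: "linear_extension C (r \<inter> C \<times> C) L"
  shows "partial_order_on A (r \<union> r O L O r)"
proof -
  have rA: "r \<subseteq> A \<times> A" and rr: "refl_on A r" and rt: "trans r" and ra: "antisym r"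
    using r by (auto simp: partial_order_on_def preorder_on_def)
  have LC: "L \<subseteq> C \<times> C" and Lt: "trans L" and La: "antisym L"
    and rL: "\<And>x y. (x, y) \<in> r \<Longrightarrow> x \<in> C \<Longrightarrow> y \<in> C \<Longrightarrow> (x, y) \<in> L"
    using L by (auto simp: linear_extension_def linear_order_on_def partial_order_on_def
        preorder_on_def)
  have LrL: "(a, b') \<in> L" if "(a, b) \<in> L" "(b, a') \<in> r" "(a', b') \<in> L" for a b a' b'
  proof -
    have "(b, a') \<in> L" using that rL LC by blast
    then show ?thesis using that transD[OF Lt] by blast
  qed
  have 1: "trans (r \<union> r O L O r)"
  proof (rule transI)
    fix x y z
    assume "(x, y) \<in> r \<union> r O L O r" "(y, z) \<in> r \<union> r O L O r"
    then consider "(x, y) \<in> r" "(y, z) \<in> r"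
      | a b where "(x, y) \<in> r" "(y, a) \<in> r" "(a, b) \<in> L" "(b, z) \<in> r"
      | a b where "(x, a) \<in> r" "(a, b) \<in> L" "(b, y) \<in> r" "(y, z) \<in> r"
      | a b a' b' where "(x, a) \<in> r" "(a, b) \<in> L" "(b, y) \<in> r" "(y, a') \<in> r" "(a', b') \<in> L"
        "(b', z) \<in> r"
      by blast
    then show "(x, z) \<in> r \<union> r O L O r"
    proof cases
      case 1
      then show ?thesis using transD[OF rt] by blast
    next
      case 2
      then have "(x, a) \<in> r" using transD[OF rt] by blast
      then show ?thesis using 2 by blast
    next
      case 3
      then have "(b, z) \<in> r" using transD[OF rt] by blast
      then show ?thesis using 3 by blast
    next
      case 4
      then have "(b, a') \<in> r" using transD[OF rt] by blast
      then have "(a, b') \<in> L" using LrL 4 by blast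
      then show ?thesis using 4 by blast
    qed
  qed
  \<comment> \<open>A cycle with a single passage \<open>(a, b)\<close> through \<open>L\<close>:
    the rest leads from \<open>b\<close> back to \<open>a\<close> in \<open>r\<close>, hence in
    \<open>L\<close>. So \<open>a = b\<close>, and the whole cycle lies in \<open>r\<close>.\<close>
  have no_cycle: "x = y" if "(x, y) \<in> r" "(y, a) \<in> r" "(a, b) \<in> L" "(b, x) \<in> r" for x y a b
  proof -
    have "(b, a) \<in> r" using that transD[OF rt] by blast
    then have "(b, a) \<in> L" using that rL LC by blast
    then have "a = b" using that antisymD[OF La] by blast
    then have "(y, x) \<in> r" using that transD[OF rt] by blast
    then show ?thesis using that antisymD[OF ra] by blast
  qed
  have 2: "antisym (r \<union> r O L O r)"
  proof (rule antisymI)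
    fix x y
    assume "(x, y) \<in> r \<union> r O L O r" "(y, x) \<in> r \<union> r O L O r"
    then consider "(x, y) \<in> r" "(y, x) \<in> r"
      | a b where "(x, y) \<in> r" "(y, a) \<in> r" "(a, b) \<in> L" "(b, x) \<in> r"
      | a b where "(y, x) \<in> r" "(x, a) \<in> r" "(a, b) \<in> L" "(b, y) \<in> r"
      | a b a' b' where "(x, a) \<in> r" "(a, b) \<in> L" "(b, y) \<in> r" "(y, a') \<in> r" "(a', b') \<in> L"
        "(b', x) \<in> r"
      by blast
    then show "x = y"
    proof cases
      case 1
      then show ?thesis using antisymD[OF ra] by blast
    next
      case 2
      then show ?thesis using no_cycle by blast
    next
      case 3
      then show ?thesis using no_cycle by blast
    next
      case 4
      \<comment> \<open>With two passages, both connecting \<open>r\<close>-steps belong to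
        \<open>L\<close> and close an \<open>L\<close>-cycle through \<open>a\<close>,
        \<open>b\<close>, \<open>a'\<close> and \<open>b'\<close>. Its collapse makes the first
        passage trivial, which leaves the case of \<open>no_cycle\<close>.\<close>
      then have "(b, a') \<in> r" "(b', a) \<in> r" using transD[OF rt] by blast+
      then have "(b, a') \<in> L" "(b', a) \<in> L" using 4 rL LC by blast+
      then have "(b, a) \<in> L" "(a', a) \<in> L" "(a, a') \<in> L" using 4 transD[OF Lt] by blast+
      then have "a = b" "a' = a" using 4 antisymD[OF La] by blast+
      then have "(x, y) \<in> r" using 4 transD[OF rt] by blast
      then show ?thesis using no_cycle 4 by blast
    qed
  qed
  have "refl_on A (r \<union> r O L O r)" "r \<union> r O L O r \<subseteq> A \<times> A"
    using rr rA by (auto simp: refl_on_def)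
  then show ?thesis
    using 1 2 by (simp add: partial_order_on_def preorder_on_def)
qed

lemma linear_extension_subset_amalgamation:
  assumes r: "partial_order_on A r" and CA: "C \<subseteq> A"
    and L: "linear_extension C (r \<inter> C \<times> C) L"
  shows "L \<subseteq> r \<union> r O L O r"
proof
  fix p assume "p \<in> L"
  then obtain x y where p: "p = (x, y)" "(x, y) \<in> L" by (cases p) auto
  then have "x \<in> A" "y \<in> A"
    using L CA by (auto simp: linear_extension_def linear_order_on_def partial_order_on_def
        preorder_on_def)
  then have "(x, x) \<in> r" "(y, y) \<in> r"
    using r by (auto simp: partial_order_on_def preorder_on_def refl_on_def)
  then show "p \<in> r \<union> r O L O r" using p by blast
qed

text \<open>Amalgamating this chain forces \<open>y\<close> below \<open>x\<close>. The move serves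
  twice: to show that a maximal order is total, and to reverse a given non-relation in some linear
  extension.\<close>

lemma linear_extension_two_points:
  assumes "(x, y) \<notin> r"
  shows "linear_extension {x, y} (r \<inter> {x, y} \<times> {x, y}) {(x, x), (y, y), (y, x)}"
  using assms
  by (auto simp: linear_extension_def linear_order_on_def partial_order_on_def preorder_on_def
      refl_on_def total_on_def intro!: transI antisymI)

text \<open>The finite case of Szpilrajn's theorem. A partial order that is maximal above
  \<open>r\<close> is total, because any unrelated pair could still be added by amalgamating a
  two-point chain.\<close>

lemma linear_extension_exists:
  assumes "finite A" and r: "partial_order_on A r"
  obtains l where "linear_extension A r l"
proof -
  let ?S = "{s. partial_order_on A s \<and> r \<subseteq> s}"
  have "finite ?S"
    by (rule finite_subset[OF _ finite_partial_orders_on[OF assms(1)]]) auto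
  moreover have "r \<in> ?S" using r by simp
  ultimately have "\<exists>l\<in>?S. r \<subseteq> l \<and> (\<forall>s\<in>?S. l \<subseteq> s \<longrightarrow> l = s)"
    by (rule finite_has_maximal2)
  then obtain l where l: "l \<in> ?S" and max: "\<And>s. s \<in> ?S \<Longrightarrow> l \<subseteq> s \<Longrightarrow> l = s"
    by (elim bexE conjE) blast
  have "(y, x) \<in> l" if "x \<in> A" "y \<in> A" "(x, y) \<notin> l" for x y
  proof -
    let ?L = "{(x, x), (y, y), (y, x)}"
    have pl: "partial_order_on A l" using l by simp
    note L = linear_extension_two_points[OF that(3)]
    have C: "{x, y} \<subseteq> A" using that by simp
    have "l \<union> l O ?L O l \<in> ?S"
      using partial_order_on_amalgamation[OF pl L] l by blast
    then have "l = l \<union> l O ?L O l" using max by blast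
    then show ?thesis
      using linear_extension_subset_amalgamation[OF pl C L] by blast
  qed
  then have "linear_extension A r l"
    using l by (auto simp: linear_extension_def linear_order_on_def total_on_def)
  then show thesis by (rule that)
qed

text \<open>Amalgamation first makes the prescribed order on \<open>C\<close> part of a partial
  order on \<open>A\<close>; any linear extension of that order will do.\<close>

lemma linear_extension_of_subposet_extends:
  assumes "finite A" and r: "partial_order_on A r" and CA: "C \<subseteq> A"
    and L: "linear_extension C (r \<inter> C \<times> C) L"
  obtains l where "linear_extension A r l" "L \<subseteq> l"
proof -
  obtain l where "linear_extension A (r \<union> r O L O r) l"
    using linear_extension_exists[OF assms(1) partial_order_on_amalgamation[OF r L]] .
  then have "linear_extension A r l" "L \<subseteq> l"
    using linear_extension_subset_amalgamation[OF r CA L] by (auto simp: linear_extension_def)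
  then show thesis by (rule that)
qed

lemma partial_order_on_Restr:
  assumes "partial_order_on A r" "C \<subseteq> A"
  shows "partial_order_on C (r \<inter> C \<times> C)"
  using assms trans_Restr[of r C] antisym_subset[of "r \<inter> C \<times> C" r]
  unfolding partial_order_on_def preorder_on_def refl_on_def by blast

section \<open>Realizers\<close>

text \<open>Replaces indexed realizers by finite sets of linear extensions. Only one direction has
  to be checked, since every linear extension contains \<open>r\<close>.\<close>

lemma order_dim_le_card:
  assumes "finite F" and lin: "\<And>l. l \<in> F \<Longrightarrow> linear_extension A r l"
    and sep: "\<And>x y. x \<in> A \<Longrightarrow> y \<in> A \<Longrightarrow> \<forall>l\<in>F. (x, y) \<in> l \<Longrightarrow> (x, y) \<in> r"
  shows "\<exists>L. realized_by A r (card F) L" and "order_dim A r \<le> card F"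
proof -
  obtain L where L: "bij_betw L {1..card F} F"
    using ex_bij_betw_nat_finite_1[OF assms(1)] by blast
  then have F: "F = L ` {1..card F}" by (simp add: bij_betw_def)
  have "realized_by A r (card F) L"
    unfolding realized_by_def
  proof (intro conjI ballI iffI)
    fix i assume "i \<in> {1..card F}"
    then show "linear_extension A r (L i)" using lin F by blast
  next
    fix x y i assume "(x, y) \<in> r" "i \<in> {1..card F}"
    then have "linear_extension A r (L i)" using lin F by blast
    then show "(x, y) \<in> L i" using \<open>(x, y) \<in> r\<close> by (auto simp: linear_extension_def)
  next
    fix x y assume "x \<in> A" "y \<in> A" and all: "\<forall>i\<in>{1..card F}. (x, y) \<in> L i"
    have "\<forall>l\<in>F. (x, y) \<in> l" using all by (subst F) blast
    then show "(x, y) \<in> r" using sep \<open>x \<in> A\<close> \<open>y \<in> A\<close> by blast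
  qed
  then show "\<exists>L. realized_by A r (card F) L" by blast
  then show "order_dim A r \<le> card F" unfolding order_dim_def by (rule Least_le)
qed

text \<open>All linear extensions together form a realizer. This gives the \<open>LEAST\<close> in
  \<open>order_dim\<close> a witness.\<close>

lemma realizer_exists:
  assumes "finite A" and r: "partial_order_on A r"
  shows "\<exists>d L. realized_by A r d L"
proof -
  let ?F = "{l. linear_extension A r l}"
  have "finite ?F"
    by (rule finite_subset[OF _ finite_partial_orders_on[OF assms(1)]])
      (auto simp: linear_extension_def linear_order_on_def)
  moreover have "(x, y) \<in> r" if xy: "x \<in> A" "y \<in> A" and all: "\<forall>l\<in>?F. (x, y) \<in> l" for x y
  proof (rule ccontr)
    assume n: "(x, y) \<notin> r"
    have "{x, y} \<subseteq> A" using xy by simp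
    then obtain l where l: "linear_extension A r l" "{(x, x), (y, y), (y, x)} \<subseteq> l"
      using linear_extension_of_subposet_extends[OF assms _ linear_extension_two_points[OF n]]
      by blast
    then have "(x, y) \<in> l" "antisym l" using all
      by (auto simp: linear_extension_def linear_order_on_def partial_order_on_def)
    then have "x = y" using l by (auto dest: antisymD)
    then show False using n r xy by (auto simp: partial_order_on_def preorder_on_def refl_on_def)
  qed
  ultimately show ?thesis using order_dim_le_card(1)[of ?F A r] by blast
qed

text \<open>A realizer can be padded with an arbitrary linear extension \<open>l\<close>. This
  allows the same number of extensions to be used for every pair of levels.\<close>

lemma realizer_of_size:
  assumes "finite A" and r: "partial_order_on A r" and "order_dim A r \<le> d"
  obtains L where "realized_by A r d L"
proof -
  have "\<exists>L. realized_by A r (order_dim A r) L"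
    unfolding order_dim_def by (rule LeastI_ex[OF realizer_exists[OF assms(1,2)]])
  then obtain L where L: "realized_by A r (order_dim A r) L" ..
  obtain l where l: "linear_extension A r l"
    using linear_extension_exists[OF assms(1,2)] .
  have "realized_by A r d (\<lambda>i. if i \<le> order_dim A r then L i else l)"
    unfolding realized_by_def
  proof (intro conjI ballI iffI)
    fix i assume "i \<in> {1..d}"
    then show "linear_extension A r (if i \<le> order_dim A r then L i else l)"
      using L l by (auto simp: realized_by_def)
  next
    fix x y i assume "(x, y) \<in> r" "i \<in> {1..d}"
    then show "(x, y) \<in> (if i \<le> order_dim A r then L i else l)"
      using L l by (auto simp: realized_by_def linear_extension_def)
  next
    fix x y
    assume xy: "x \<in> A" "y \<in> A"
      and all: "\<forall>i\<in>{1..d}. (x, y) \<in> (if i \<le> order_dim A r then L i else l)"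
    have "(x, y) \<in> L i" if "i \<in> {1..order_dim A r}" for i
      using bspec[OF all, of i] that assms(3) by auto
    then show "(x, y) \<in> r" using L xy by (auto simp: realized_by_def)
  qed
  then show thesis by (rule that)
qed

section \<open>Simultaneous extension over disjoint intervals of levels\<close>

text \<open>The value \<open>b x\<close> is the block of \<open>x\<close>. Blocks are stacked in
  increasing order, and \<open>l n\<close> decides inside block \<open>n\<close>, although it is an
  order on all of \<open>A\<close>.\<close>

lemma linear_extension_lexicographic:
  fixes b :: "'a \<Rightarrow> 'b::linorder"
  assumes l: "\<And>n. linear_extension A r (l n)"
    and b: "\<And>x y. (x, y) \<in> r \<Longrightarrow> b x \<le> b y"
  shows "linear_extension A r
    {(x, y) \<in> A \<times> A. b x < b y \<or> b x = b y \<and> (x, y) \<in> l (b x)}" (is "linear_extension A r ?E")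
proof -
  have sub: "\<And>n. l n \<subseteq> A \<times> A" and ext: "\<And>n. r \<subseteq> l n"
    and tr: "\<And>n. trans (l n)" and an: "\<And>n. antisym (l n)" and re: "\<And>n. refl_on A (l n)"
    and tot: "\<And>n. total_on A (l n)"
    using l by (auto simp: linear_extension_def linear_order_on_def partial_order_on_def
        preorder_on_def)
  have "trans ?E"
    by (rule transI) (auto intro: transD[OF tr])
  moreover have "antisym ?E"
    by (rule antisymI) (auto intro: antisymD[OF an])
  moreover have "refl_on A ?E" using re by (auto simp: refl_on_def)
  moreover have "total_on A ?E" using tot by (fastforce simp: total_on_def)
  moreover have "r \<subseteq> ?E"
  proof (rule subrelI)
    fix x y assume xy: "(x, y) \<in> r"
    then have "(x, y) \<in> l (b x)" "(x, y) \<in> A \<times> A" using ext sub by blast+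
    then show "(x, y) \<in> ?E" using b[OF xy] by auto
  qed
  ultimately show ?thesis
    by (auto simp: linear_extension_def linear_order_on_def partial_order_on_def preorder_on_def)
qed

text \<open>Cut the levels into blocks at the left endpoints of the intervals in \<open>M\<close>.
  By disjointness each interval stays within one block, so stacking the blocks leaves each
  \<open>L i j\<close> free to be prescribed.\<close>

lemma disjoint_intervals_common_extension:
  fixes lev :: "'a \<Rightarrow> nat" and M :: "(nat \<times> nat) set"
  assumes fin: "finite A" and r: "partial_order_on A r"
    and lev: "\<And>x y. (x, y) \<in> r \<Longrightarrow> lev x \<le> lev y"
    and finM: "finite M"
    and le: "\<And>i j. (i, j) \<in> M \<Longrightarrow> i \<le> j"
    and disj: "\<And>i j i' j'. (i, j) \<in> M \<Longrightarrow> (i', j') \<in> M \<Longrightarrow> (i, j) \<noteq> (i', j') \<Longrightarrow>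
      {i..j} \<inter> {i'..j'} = {}"
    and C: "\<And>i j. (i, j) \<in> M \<Longrightarrow> C i j \<subseteq> A"
    and levC: "\<And>i j x. (i, j) \<in> M \<Longrightarrow> x \<in> C i j \<Longrightarrow> lev x \<in> {i..j}"
    and L: "\<And>i j. (i, j) \<in> M \<Longrightarrow> linear_extension (C i j) (r \<inter> C i j \<times> C i j) (L i j)"
  shows "\<exists>E. linear_extension A r E \<and> (\<forall>(i, j)\<in>M. L i j \<subseteq> E)"
proof -
  \<comment> \<open>Intervals with a common left endpoint meet, so the left endpoint alone can index
    the extensions \<open>l\<close>.\<close>
  have unique: "j = j'" if "(i, j) \<in> M" "(i, j') \<in> M" for i j j'
    using disj[OF that] le[OF that(1)] le[OF that(2)] by auto
  have "\<exists>l. linear_extension A r l \<and> (\<forall>j. (n, j) \<in> M \<longrightarrow> L n j \<subseteq> l)" for n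
  proof (cases "\<exists>j. (n, j) \<in> M")
    case True
    then obtain j where j: "(n, j) \<in> M" by blast
    then obtain l where "linear_extension A r l" "L n j \<subseteq> l"
      using linear_extension_of_subposet_extends[OF fin r C[OF j] L[OF j]] by blast
    then show ?thesis using unique[OF j] by blast
  next
    case False
    then show ?thesis using linear_extension_exists[OF fin r] by blast
  qed
  then obtain l where l: "\<And>n. linear_extension A r (l n)"
    and lL: "\<And>n j. (n, j) \<in> M \<Longrightarrow> L n j \<subseteq> l n"
    by metis
  \<comment> \<open>The block of level \<open>k\<close> is named by the last left endpoint not above
    \<open>k\<close>. The inserted 0 keeps the set nonempty and names the block of the levels before
    the first interval.\<close>
  define \<beta> where "\<beta> k = Max (insert 0 {i \<in> fst ` M. i \<le> k})" for k
  have "\<beta> k \<le> \<beta> k'" if "k \<le> k'" for k k'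
    unfolding \<beta>_def by (rule Max_mono) (use that finM in auto)
  then have mono: "\<And>x y. (x, y) \<in> r \<Longrightarrow> \<beta> (lev x) \<le> \<beta> (lev y)" using lev by blast
  \<comment> \<open>A left endpoint \<open>i'\<close> with \<open>i < i' \<le> k\<close> would lie
    in both intervals.\<close>
  have \<beta>: "\<beta> k = i" if ij: "(i, j) \<in> M" and k: "k \<in> {i..j}" for i j k
    unfolding \<beta>_def
  proof (rule Max_eqI)
    show "finite (insert 0 {i \<in> fst ` M. i \<le> k})" using finM by simp
    show "i \<in> insert 0 {i \<in> fst ` M. i \<le> k}" using ij k by force
    fix i' assume "i' \<in> insert 0 {i \<in> fst ` M. i \<le> k}"
    then consider "i' = 0" | j' where "(i', j') \<in> M" "i' \<le> k" by auto
    then show "i' \<le> i"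
    proof cases
      case 2
      show ?thesis
      proof (rule ccontr)
        assume "\<not> i' \<le> i"
        then have "i' \<in> {i..j} \<inter> {i'..j'}" using 2 k le[OF 2(1)] by auto
        then show False using disj[OF ij 2(1)] \<open>\<not> i' \<le> i\<close> by auto
      qed
    qed simp
  qed
  let ?E = "{(x, y) \<in> A \<times> A. \<beta> (lev x) < \<beta> (lev y) \<or>
    \<beta> (lev x) = \<beta> (lev y) \<and> (x, y) \<in> l (\<beta> (lev x))}"
  have "linear_extension A r ?E"
    by (rule linear_extension_lexicographic[where b = "\<lambda>x. \<beta> (lev x)", OF l mono])
  moreover have "L i j \<subseteq> ?E" if ij: "(i, j) \<in> M" for i j
  proof (rule subrelI)
    fix x y assume xy: "(x, y) \<in> L i j"
    then have "x \<in> C i j" "y \<in> C i j"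
      using L[OF ij] by (auto simp: linear_extension_def linear_order_on_def partial_order_on_def
        preorder_on_def)
    then show "(x, y) \<in> ?E"
      using \<beta>[OF ij levC[OF ij]] C[OF ij] lL[OF ij] xy by auto
  qed
  ultimately show ?thesis by blast
qed

section \<open>Colouring intervals\<close>

text \<open>Greedy colouring by increasing left endpoint: the earlier intervals that meet the new
  one all contain its left endpoint, so fewer than \<open>N\<close> colours are blocked.\<close>

lemma interval_colouring:
  fixes S :: "('a::linorder \<times> 'a) set"
  assumes "finite S" and "\<And>i j. (i, j) \<in> S \<Longrightarrow> i \<le> j"
    and "\<And>p. card {(i, j) \<in> S. p \<in> {i..j}} \<le> N"
  shows "\<exists>c. c ` S \<subseteq> {..<N} \<and> (\<forall>i j i' j'. (i, j) \<in> S \<longrightarrow> (i', j') \<in> S \<longrightarrow>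
    c (i, j) = c (i', j') \<longrightarrow> (i, j) \<noteq> (i', j') \<longrightarrow> {i..j} \<inter> {i'..j'} = {})"
  using assms
proof (induction S rule: finite_ranking_induct[where f = fst])
  case empty
  then show ?case by simp
next
  case (insert s S)
  show ?case
  \<comment> \<open>The ranking induction does not make \<open>s\<close> a new element.\<close>
  proof (cases "s \<in> S")
    case True
    then show ?thesis using insert by (simp add: insert_absorb)
  next
    case s: False
    obtain a b where ab: "s = (a, b)" by (cases s)
    have "card {(i, j) \<in> S. p \<in> {i..j}} \<le> N" for p
    proof (rule le_trans[OF card_mono insert.prems(2)[of p]])
      show "finite {(i, j) \<in> insert s S. p \<in> {i..j}}"
        by (rule finite_subset[of _ "insert s S"]) (use insert.hyps(1) in auto)
    qed auto
    then have "\<exists>c. c ` S \<subseteq> {..<N} \<and> (\<forall>i j i' j'. (i, j) \<in> S \<longrightarrow> (i', j') \<in> S \<longrightarrow>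
      c (i, j) = c (i', j') \<longrightarrow> (i, j) \<noteq> (i', j') \<longrightarrow> {i..j} \<inter> {i'..j'} = {})"
      by (intro insert.IH) (use insert.prems(1) in blast)+
    then obtain c where c: "c ` S \<subseteq> {..<N}"
      and cd: "\<And>i j i' j'. (i, j) \<in> S \<Longrightarrow> (i', j') \<in> S \<Longrightarrow> c (i, j) = c (i', j') \<Longrightarrow>
        (i, j) \<noteq> (i', j') \<Longrightarrow> {i..j} \<inter> {i'..j'} = {}"
      by metis
    have "a \<le> b" using insert.prems(1) ab by simp
    \<comment> \<open>The new interval itself contains \<open>a\<close> and uses up one of the
      \<open>N\<close> places there, so the members of \<open>?T\<close> occupy at most
      \<open>N - 1\<close> colours.\<close>
    let ?T = "{(i, j) \<in> S. a \<in> {i..j}}"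
    have "{(i, j) \<in> insert s S. a \<in> {i..j}} = insert s ?T" using ab \<open>a \<le> b\<close> by auto
    then have "card (insert s ?T) \<le> N" using insert.prems(2)[of a] by simp
    moreover have finT: "finite ?T" by (rule finite_subset[OF _ insert.hyps(1)]) auto
    moreover have "s \<notin> ?T" using s by blast
    ultimately have "card ?T < N" using card_insert_disjoint[of ?T s] by linarith
    then have "card (c ` ?T) < card {..<N}" using card_image_le[OF finT, of c] by simp
    then have "\<not> {..<N} \<subseteq> c ` ?T"
      using card_mono[OF finite_imageI[OF finT], of "{..<N}" c] by linarith
    then obtain n where n: "n < N" "n \<notin> c ` ?T" by blast
    \<comment> \<open>As \<open>a\<close> is the largest left endpoint, every interval that meets \<open>[a, b]\<close> contains \<open>a\<close>.\<close>
    have new: "{i..j} \<inter> {a..b} = {}" if "(i, j) \<in> S" "c (i, j) = n" for i j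
    proof -
      have "(i, j) \<notin> ?T" using n(2) that(2) by blast
      moreover have "i \<le> a" using insert.hyps(2)[OF that(1)] ab by simp
      ultimately have "j < a" using that(1) by auto
      then show ?thesis by auto
    qed
    have "(c(s := n)) ` insert s S \<subseteq> {..<N}" using c n(1) by auto
    moreover have "{i..j} \<inter> {i'..j'} = {}"
      if "(i, j) \<in> insert s S" "(i', j') \<in> insert s S" "(c(s := n)) (i, j) = (c(s := n)) (i', j')"
        "(i, j) \<noteq> (i', j')" for i j i' j'
    proof (cases "(i, j) = s")
      case True
      then have "(i', j') \<in> S" "c (i', j') = n" using that by (auto split: if_splits)
      then show ?thesis using new[of i' j'] True ab by auto
    next
      case False
      show ?thesis
      proof (cases "(i', j') = s")
        case True
        then have "(i, j) \<in> S" "c (i, j) = n" using that False by (auto split: if_splits)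
        then show ?thesis using new[of i j] True ab by auto
      next
        case False': False
        then show ?thesis using that False cd by auto
      qed
    qed
    ultimately show ?thesis by (intro exI[of _ "c(s := n)"] conjI allI impI)
  qed
qed

text \<open>Endpoints on the two sides of \<open>p\<close> form a grid of \<open>p * q\<close> pairs
  with \<open>q = m + 1 - p\<close>, from which the degenerate pair \<open>(p, p)\<close> is
  removed. The bound is \<open>4 * p * q \<le> (p + q)\<^sup>2\<close> with
  \<open>(m + 1)\<^sup>2 = (m - 1) * (m + 3) + 4\<close>; the removed pair absorbs the 4.\<close>

lemma card_intervals_through_point:
  fixes m p :: nat
  shows "card {(i, j). 1 \<le> i \<and> i < j \<and> j \<le> m \<and> p \<in> {i..j}} \<le> (m - 1) * (m + 3) div 4"
    (is "card ?T \<le> _")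
proof (cases "1 \<le> p \<and> p \<le> m")
  case True
  define q where "q = m + 1 - p"
  have m: "m + 1 = p + q" using True by (auto simp: q_def)
  have "?T \<subseteq> {1..p} \<times> {p..m} - {(p, p)}" by auto
  then have "card ?T \<le> card ({1..p} \<times> {p..m} - {(p, p)})" by (intro card_mono) auto
  also have "\<dots> = p * q - 1"
    using True by (subst card_Diff_singleton) (auto simp: q_def Suc_diff_le)
  also have "p * q - 1 \<le> (m - 1) * (m + 3) div 4"
  proof -
    \<comment> \<open>The computation runs in the integers, where \<open>p - q\<close> may be
      negative.\<close>
    have "4 * (int p * int q) \<le> (int p + int q)\<^sup>2"
      using zero_le_power2[of "int p - int q"] by (simp add: power2_eq_square algebra_simps)
    also have "\<dots> = (int m - 1) * (int m + 3) + 4"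
    proof -
      have "int p + int q = int m + 1" using m by linarith
      then show ?thesis by (simp add: power2_eq_square algebra_simps)
    qed
    also have "(int m - 1) * (int m + 3) = int ((m - 1) * (m + 3))"
      using True by (simp add: of_nat_diff)
    finally have "4 * (p * q) \<le> (m - 1) * (m + 3) + 4"
      by (metis (mono_tags) of_nat_add of_nat_le_iff of_nat_mult of_nat_numeral)
    then have "4 * (p * q - 1) \<le> (m - 1) * (m + 3)" by linarith
    then show ?thesis by (simp add: less_eq_div_iff_mult_less_eq mult.commute)
  qed
  finally show ?thesis .
next
  case False
  then have "?T = {}" by auto
  then show ?thesis by (simp only: card.empty le0)
qed

section \<open>The dimension bound\<close>

theorem theorem1:
  fixes m :: nat and X :: "nat \<Rightarrow> 'a set" and r :: "'a rel"
  assumes "m \<ge> 2"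
    and "multipartite_poset m X r"
  shows "multipartite_dim m X r \<le> ((m - 1) * (m + 3) div 4) * max_pair_dim m X r"
proof -
  define A where "A = (\<Union>i\<in>{1..m}. X i)"
  define N where "N = (m - 1) * (m + 3) div 4"
  define B where "B = max_pair_dim m X r"
  define S where "S = {(i, j). 1 \<le> i \<and> i < j \<and> j \<le> m}"
  define C where "C i j = X i \<union> X j" for i j
  have fin: "finite A" and disj: "disjoint_family_on X {1..m}" and r: "partial_order_on A r"
    and r_lev: "\<And>x y. (x, y) \<in> r \<Longrightarrow> x \<noteq> y \<Longrightarrow>
        \<exists>i\<in>{1..m}. \<exists>j\<in>{1..m}. x \<in> X i \<and> y \<in> X j \<and> i < j"
    using assms(2) by (auto simp: multipartite_poset_def A_def)
  have SI: "(i, j) \<in> S \<longleftrightarrow> 1 \<le> i \<and> i < j \<and> j \<le> m" for i j by (simp add: S_def)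
  have finS: "finite S" by (rule finite_subset[of _ "{1..m} \<times> {1..m}"]) (auto simp: S_def)
  have CA: "C i j \<subseteq> A" if "(i, j) \<in> S" for i j 
  proof -
    have "i \<in> {1..m}" "j \<in> {1..m}" using that by (auto simp: SI)
    then show ?thesis unfolding C_def A_def by blast
  qed
  \<comment> \<open>Disjointness of the levels makes this description unique on
    \<open>A\<close>.\<close>
  define lev where "lev x = (THE i. i \<in> {1..m} \<and> x \<in> X i)" for x
  have lev: "lev x = i" if "i \<in> {1..m}" "x \<in> X i" for x i
    unfolding lev_def
    by (rule the_equality) (use that disj in \<open>unfold disjoint_family_on_def, blast+\<close>)
  have lev_mono: "lev x \<le> lev y" if "(x, y) \<in> r" for x y
  proof (cases "x = y")
    case False
    then obtain i j where "i \<in> {1..m}" "j \<in> {1..m}" "x \<in> X i" "y \<in> X j" "i < j"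
      using r_lev \<open>(x, y) \<in> r\<close> by blast
    then show ?thesis using lev[of i x] lev[of j y] by simp
  qed simp
  have lev_C: "lev x \<in> {i..j}" if "(i, j) \<in> S" "x \<in> C i j" for i j x
  proof -
    have "i \<in> {1..m}" "j \<in> {1..m}" "i < j" using that(1) by (auto simp: SI)
    then show ?thesis using that(2) lev[of i x] lev[of j x] by (auto simp: C_def)
  qed
  have "\<exists>L. realized_by (C i j) (r \<inter> C i j \<times> C i j) B L" if ij: "(i, j) \<in> S" for i j
  proof -
    have "finite ((\<lambda>(i, j). pair_dim X r i j) ` S)" using finS by simp
    also have "(\<lambda>(i, j). pair_dim X r i j) ` S = {pair_dim X r i j |i j. 1 \<le> i \<and> i < j \<and> j \<le> m}"
      by (auto simp: S_def)
    finally have "pair_dim X r i j \<le> B"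
      unfolding B_def max_pair_dim_def by (rule Max_ge) (use ij SI in blast)
    then have "order_dim (C i j) (r \<inter> C i j \<times> C i j) \<le> B" by (simp add: pair_dim_def C_def)
    then show ?thesis
      using realizer_of_size finite_subset[OF CA[OF ij] fin] partial_order_on_Restr[OF r CA[OF ij]]
      by metis
  qed
  then obtain L where L: "\<And>i j. (i, j) \<in> S \<Longrightarrow>
      realized_by (C i j) (r \<inter> C i j \<times> C i j) B (L i j)"
    by metis
  have "card {(i, j) \<in> S. p \<in> {i..j}} \<le> N" for p
    using card_intervals_through_point[of m p] by (simp add: S_def N_def conj_ac)
  then have "\<exists>c. c ` S \<subseteq> {..<N} \<and> (\<forall>i j i' j'. (i, j) \<in> S \<longrightarrow> (i', j') \<in> S \<longrightarrow>
      c (i, j) = c (i', j') \<longrightarrow> (i, j) \<noteq> (i', j') \<longrightarrow> {i..j} \<inter> {i'..j'} = {})"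
    by (intro interval_colouring[OF finS]) (auto simp: SI)
  then obtain c where c: "c ` S \<subseteq> {..<N}"
    and c_disj: "\<And>i j i' j'. (i, j) \<in> S \<Longrightarrow> (i', j') \<in> S \<Longrightarrow> c (i, j) = c (i', j') \<Longrightarrow>
      (i, j) \<noteq> (i', j') \<Longrightarrow> {i..j} \<inter> {i'..j'} = {}"
    by metis
  \<comment> \<open>Intervals of one colour \<open>n\<close> are pairwise disjoint, so their
    \<open>k\<close>-th extensions fit into a single linear extension of the whole poset.\<close>
  have ex: "\<exists>E. linear_extension A r E \<and> (\<forall>(i, j)\<in>{s \<in> S. c s = n}. L i j k \<subseteq> E)"
    if k: "k \<in> {1..B}" for n k
  proof (rule disjoint_intervals_common_extension[where C = C, OF fin r lev_mono])
    show "finite {s \<in> S. c s = n}" using finS by simp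
    show "linear_extension (C i j) (r \<inter> C i j \<times> C i j) (L i j k)"
      if "(i, j) \<in> {s \<in> S. c s = n}" for i j
      using L[of i j] that k by (auto simp: realized_by_def)
    show "{i..j} \<inter> {i'..j'} = {}"
      if "(i, j) \<in> {s \<in> S. c s = n}" "(i', j') \<in> {s \<in> S. c s = n}" "(i, j) \<noteq> (i', j')"
      for i j i' j'
      using c_disj[of i j i' j'] that by simp
  qed (use CA lev_C SI in auto)
  define E where "E n k = (SOME E. linear_extension A r E \<and>
    (\<forall>(i, j)\<in>{s \<in> S. c s = n}. L i j k \<subseteq> E))" for n k
  have E: "linear_extension A r (E n k)"
    and E_sup: "\<forall>(i, j)\<in>{s \<in> S. c s = n}. L i j k \<subseteq> E n k" if "k \<in> {1..B}" for n k
    using someI_ex[OF ex[OF that, of n]] unfolding E_def by blast+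
  have LE: "L i j k \<subseteq> E (c (i, j)) k" if "k \<in> {1..B}" "(i, j) \<in> S" for i j k
    using E_sup[OF that(1), of "c (i, j)"] that(2) by blast
  let ?F = "(\<lambda>(n, k). E n k) ` ({..<N} \<times> {1..B})"
  have "order_dim A r \<le> card ?F"
  proof (rule order_dim_le_card(2))
    fix x y assume xy: "x \<in> A" "y \<in> A" and all: "\<forall>l\<in>?F. (x, y) \<in> l"
    obtain u v where u: "u \<in> {1..m}" "x \<in> X u" and v: "v \<in> {1..m}" "y \<in> X v"
      using xy by (auto simp: A_def)
    \<comment> \<open>Two points of the same level also need a pair that contains them. Level
      \<open>m\<close> serves as partner, and level 1 does so for level \<open>m\<close> itself,
      which is where \<open>m \<ge> 2\<close> enters.\<close>
    have "\<exists>i j. (i, j) \<in> S \<and> x \<in> C i j \<and> y \<in> C i j"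
    proof -
      consider "u < v" | "v < u" | "u = v" "u < m" | "u = v" "u = m" using u by fastforce
      then show ?thesis
      proof cases
        case 1
        then show ?thesis using u v by (intro exI[of _ u] exI[of _ v]) (auto simp: SI C_def)
      next
        case 2
        then show ?thesis using u v by (intro exI[of _ v] exI[of _ u]) (auto simp: SI C_def)
      next
        case 3
        then show ?thesis using u v by (intro exI[of _ u] exI[of _ m]) (auto simp: SI C_def)
      next
        case 4
        then show ?thesis using u v assms(1) by (intro exI[of _ 1] exI[of _ m]) (auto simp: SI C_def)
      qed
    qed
    then obtain i j where ij: "(i, j) \<in> S" and xyC: "x \<in> C i j" "y \<in> C i j" by blast
    \<comment> \<open>Otherwise totality puts \<open>(y, x)\<close> into \<open>L i j k\<close> and
      hence into \<open>E (c (i, j)) k\<close>. That order also contains \<open>(x, y)\<close>,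
      against antisymmetry.\<close>
    have "(x, y) \<in> L i j k" if k: "k \<in> {1..B}" for k
    proof (rule ccontr)
      assume n: "(x, y) \<notin> L i j k"
      have "linear_order_on (C i j) (L i j k)"
        using L[OF ij] k by (auto simp: realized_by_def linear_extension_def)
      then have "x \<noteq> y" "(y, x) \<in> L i j k"
        using n xyC unfolding linear_order_on_def partial_order_on_def preorder_on_def
          refl_on_def total_on_def by metis+
      moreover have "L i j k \<subseteq> E (c (i, j)) k" by (rule LE[OF k ij])
      moreover have "c (i, j) < N" using c ij by auto
      then have "(x, y) \<in> E (c (i, j)) k" using all k by auto
      moreover have "antisym (E (c (i, j)) k)"
        using E[OF k] by (auto simp: linear_extension_def linear_order_on_def partial_order_on_def)
      ultimately show False by (auto dest: antisymD)
    qed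
    then show "(x, y) \<in> r" using L[OF ij] xyC by (auto simp: realized_by_def)
  qed (use E in auto)
  \<comment> \<open>Different index pairs may yield the same extension, so the count is an
    inequality.\<close>
  also have "\<dots> \<le> card ({..<N} \<times> {1..B})" by (rule card_image_le) simp
  finally show ?thesis by (simp add: multipartite_dim_def A_def N_def B_def)
qed

end
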